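(* Let $N$ be a unital, zero-symmetric (right) loop near-ring. Every quasiregular left ideal in $N$ is contained in $J_2(N)$. The radical $J_2(N)$ is quasiregular if and only if $J_2(N)=R(N)$, and $J_2(N)$ is the largest quasiregular ideal of $N$ in this case.
   Context: Loops. A loop is a set $G$ with a binary operation $+$ and an element $0$ such that $0+a=a+0=a$ for all $a\in G$, and for all $a,b\in G$ the equations $a+x=b$ and $y+a=b$ have unique solutions $x,y\in G$. A subloop is a nonempty subset closed under $+$ and under forming the solutions $x,y$ of these equations. A subloop $K$ of $G$ is normal if $a+K=K+a$, $(a+b)+K=a+(b+K)$ and $(K+a)+b=K+(a+b)$ for all $a,b\in G$. Loop near-rings. A (right) loop near-ring is a set $N$ with operations $+,\cdot$ such that $(N,+)$ is a loop, $(N,\cdot)$ is a semigroup, and $(m_1+m_2)n=m_1n+m_2n$ for all $m_1,m_2,n\in N$. It is unital if it has a two-sided multiplicative identity $1$, and zero-symmetric if $n0=0$ for all $n\in N$. Substructures. A left $N$-subloop of $N$ is a subloop $I$ of $(N,+)$ with $NI\subseteq I$; it is maximal if it is maximal among the left $N$-subloops different from $N$. A left ideal of $N$ is a normal subloop $K$ of $(N,+)$ such that $n(a+k)+K=na+K$ for all $n,a\in N$, $k\in K$ (equivalently, the kernel of a homomorphism of left $N$-modules out of $N$). An ideal is a left ideal $K$ with $KN\subseteq K$. A left ideal is $N$-maximal if it is a maximal left $N$-subloop. $J_2(N)$ is the intersection of all $N$-maximal left ideals of $N$ (with $J_2(N)=N$ if there are none); it is a two-sided ideal of $N$. $R(N)$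 is the intersection of all maximal left $N$-subloops of $N$ (with the empty intersection equal to $N$). An element $q\in N$ is quasiregular if the unique solution $y$ of $y+q=1$ has a left inverse, i.e. there is $y^\lambda\in N$ with $y^\lambda y=1$. A subset of $N$ is quasiregular if all its elements are. *)

theory Defs
  imports "HOL-Algebra.AbelCoset"
begin

text \<open>
  Loops are represented by monoid records, so that \<^term>\<open>add_monoid N\<close> is the additive loop
  of a ring record \<open>N\<close>.
\<close>

locale loop =
  fixes G :: "('a, 'b) monoid_scheme" (structure)
  assumes m_closed: "\<lbrakk>a \<in> carrier G; b \<in> carrier G\<rbrakk> \<Longrightarrow> a \<otimes> b \<in> carrier G"
    and one_closed: "\<one> \<in> carrier G"
    and l_one: "a \<in> carrier G \<Longrightarrow> \<one> \<otimes> a = a"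
    and r_one: "a \<in> carrier G \<Longrightarrow> a \<otimes> \<one> = a"
    and right_solution:
      "\<lbrakk>a \<in> carrier G; b \<in> carrier G\<rbrakk> \<Longrightarrow> \<exists>!x. x \<in> carrier G \<and> a \<otimes> x = b"
    and left_solution:
      "\<lbrakk>a \<in> carrier G; b \<in> carrier G\<rbrakk> \<Longrightarrow> \<exists>!y. y \<in> carrier G \<and> y \<otimes> a = b"

definition subloop :: "'a set \<Rightarrow> ('a, 'b) monoid_scheme \<Rightarrow> bool" where
  "subloop H G \<longleftrightarrow> H \<subseteq> carrier G \<and> H \<noteq> {} \<and>
    (\<forall>a\<in>H. \<forall>b\<in>H. a \<otimes>\<^bsub>G\<^esub> b \<in> H) \<and>
    (\<forall>a\<in>H. \<forall>b\<in>H. \<forall>x\<in>carrier G. a \<otimes>\<^bsub>G\<^esub> x = b \<longrightarrow> x \<in> H) \<and>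
    (\<forall>a\<in>H. \<forall>b\<in>H. \<forall>y\<in>carrier G. y \<otimes>\<^bsub>G\<^esub> a = b \<longrightarrow> y \<in> H)"

definition normal_subloop :: "'a set \<Rightarrow> ('a, 'b) monoid_scheme \<Rightarrow> bool" where
  "normal_subloop K G \<longleftrightarrow> subloop K G \<and>
    (\<forall>a\<in>carrier G. a <#\<^bsub>G\<^esub> K = K #>\<^bsub>G\<^esub> a) \<and>
    (\<forall>a\<in>carrier G. \<forall>b\<in>carrier G. (a \<otimes>\<^bsub>G\<^esub> b) <#\<^bsub>G\<^esub> K = a <#\<^bsub>G\<^esub> (b <#\<^bsub>G\<^esub> K)) \<and>
    (\<forall>a\<in>carrier G. \<forall>b\<in>carrier G. (K #>\<^bsub>G\<^esub> a) #>\<^bsub>G\<^esub> b = K #>\<^bsub>G\<^esub> (a \<otimes>\<^bsub>G\<^esub> b))"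

text \<open>
  Only right distributivity is required. The \<open>one\<close> field of the record is irrelevant in
  \<open>loop_near_ring\<close>; it carries the identity in the unital case.
\<close>

locale loop_near_ring =
  fixes N :: "('a, 'b) ring_scheme" (structure)
  assumes add_loop: "loop (add_monoid N)"
    and mult_closed: "\<lbrakk>m \<in> carrier N; n \<in> carrier N\<rbrakk> \<Longrightarrow> m \<otimes> n \<in> carrier N"
    and mult_assoc: "\<lbrakk>l \<in> carrier N; m \<in> carrier N; n \<in> carrier N\<rbrakk>
      \<Longrightarrow> (l \<otimes> m) \<otimes> n = l \<otimes> (m \<otimes> n)"
    and right_distrib: "\<lbrakk>m\<^sub>1 \<in> carrier N; m\<^sub>2 \<in> carrier N; n \<in> carrier N\<rbrakk>
      \<Longrightarrow> (m\<^sub>1 \<oplus> m\<^sub>2) \<otimes> n = (m\<^sub>1 \<otimes> n) \<oplus> (m\<^sub>2 \<otimes> n)"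

locale unital_loop_near_ring = loop_near_ring N for N :: "('a, 'b) ring_scheme" (structure) +
  assumes one_in_carrier: "\<one> \<in> carrier N"
    and mult_one_left: "n \<in> carrier N \<Longrightarrow> \<one> \<otimes> n = n"
    and mult_one_right: "n \<in> carrier N \<Longrightarrow> n \<otimes> \<one> = n"

definition zero_symmetric :: "('a, 'b) ring_scheme \<Rightarrow> bool" where
  "zero_symmetric N \<longleftrightarrow> (\<forall>n\<in>carrier N. n \<otimes>\<^bsub>N\<^esub> \<zero>\<^bsub>N\<^esub> = \<zero>\<^bsub>N\<^esub>)"

definition left_N_subloop :: "('a, 'b) ring_scheme \<Rightarrow> 'a set \<Rightarrow> bool" where
  "left_N_subloop N I \<longleftrightarrow> subloop I (add_monoid N) \<and>
    (\<forall>n\<in>carrier N. \<forall>i\<in>I. n \<otimes>\<^bsub>N\<^esub> i \<in> I)"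

definition maximal_left_N_subloop :: "('a, 'b) ring_scheme \<Rightarrow> 'a set \<Rightarrow> bool" where
  "maximal_left_N_subloop N M \<longleftrightarrow> left_N_subloop N M \<and> M \<noteq> carrier N \<and>
    (\<forall>I. left_N_subloop N I \<and> I \<noteq> carrier N \<and> M \<subseteq> I \<longrightarrow> I = M)"

definition left_ideal :: "('a, 'b) ring_scheme \<Rightarrow> 'a set \<Rightarrow> bool" where
  "left_ideal N K \<longleftrightarrow> normal_subloop K (add_monoid N) \<and>
    (\<forall>n\<in>carrier N. \<forall>a\<in>carrier N. \<forall>k\<in>K.
      (n \<otimes>\<^bsub>N\<^esub> (a \<oplus>\<^bsub>N\<^esub> k)) <+\<^bsub>N\<^esub> K = (n \<otimes>\<^bsub>N\<^esub> a) <+\<^bsub>N\<^esub> K)"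

definition two_sided_ideal :: "('a, 'b) ring_scheme \<Rightarrow> 'a set \<Rightarrow> bool" where
  "two_sided_ideal N K \<longleftrightarrow> left_ideal N K \<and> (\<forall>k\<in>K. \<forall>n\<in>carrier N. k \<otimes>\<^bsub>N\<^esub> n \<in> K)"

definition N_maximal_left_ideal :: "('a, 'b) ring_scheme \<Rightarrow> 'a set \<Rightarrow> bool" where
  "N_maximal_left_ideal N K \<longleftrightarrow> left_ideal N K \<and> maximal_left_N_subloop N K"

text \<open>Intersecting with the carrier makes the empty intersection equal to \<open>N\<close>.\<close>

definition J\<^sub>2 :: "('a, 'b) ring_scheme \<Rightarrow> 'a set" where
  "J\<^sub>2 N = carrier N \<inter> \<Inter> {K. N_maximal_left_ideal N K}"

definition R_radical :: "('a, 'b) ring_scheme \<Rightarrow> 'a set" where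
  "R_radical N = carrier N \<inter> \<Inter> {M. maximal_left_N_subloop N M}"

definition quasiregular_elem :: "('a, 'b) ring_scheme \<Rightarrow> 'a \<Rightarrow> bool" where
  "quasiregular_elem N q \<longleftrightarrow> q \<in> carrier N \<and>
    (\<exists>z\<in>carrier N. z \<otimes>\<^bsub>N\<^esub> (THE y. y \<in> carrier N \<and> y \<oplus>\<^bsub>N\<^esub> q = \<one>\<^bsub>N\<^esub>) = \<one>\<^bsub>N\<^esub>)"

definition quasiregular :: "('a, 'b) ring_scheme \<Rightarrow> 'a set \<Rightarrow> bool" where
  "quasiregular N Q \<longleftrightarrow> (\<forall>q\<in>Q. quasiregular_elem N q)"

end

theory Submission
  imports Defs
begin

text \<open>
  A quasiregular left ideal \<open>L\<close> lies in every maximal left \<open>N\<close>-subloop \<open>M\<close>: otherwise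
  \<open>M + L = N\<close>, so \<open>1 = y + q\<close> with \<open>y \<in> M\<close> and \<open>q \<in> L\<close>, and the left invertibility of \<open>y\<close>
  gives \<open>1 \<in> M\<close>. Conversely, \<open>R(N)\<close> is always quasiregular: if \<open>y + q = 1\<close> with
  \<open>q \<in> R(N)\<close> and \<open>y\<close> had no left inverse, then the left \<open>N\<close>-subloop \<open>Ny\<close> would be proper,
  and a maximal left \<open>N\<close>-subloop above it would contain both \<open>y\<close> and \<open>q\<close>, hence \<open>1\<close>.
  Finally, \<open>J\<^sub>2(N)\<close> is closed under right multiplication by \<open>n\<close> because, for an \<open>N\<close>-maximal left
  ideal \<open>K\<close>, the left ideal of all \<open>x\<close> with \<open>xn \<in> K\<close> is either \<open>N\<close> or again
  \<open>N\<close>-maximal.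
\<close>

section \<open>Normal subloops\<close>

lemma mem_l_coset_iff: "y \<in> a <#\<^bsub>G\<^esub> K \<longleftrightarrow> (\<exists>k\<in>K. y = a \<otimes>\<^bsub>G\<^esub> k)"
  by (auto simp: l_coset_def)

lemma mem_r_coset_iff: "y \<in> K #>\<^bsub>G\<^esub> a \<longleftrightarrow> (\<exists>k\<in>K. y = k \<otimes>\<^bsub>G\<^esub> a)"
  by (auto simp: r_coset_def)

lemma mem_set_mult_iff: "x \<in> M <#>\<^bsub>G\<^esub> K \<longleftrightarrow> (\<exists>m\<in>M. x \<in> m <#\<^bsub>G\<^esub> K)"
  by (auto simp: set_mult_def l_coset_def)

text \<open>The division clauses are put as cancellation: the right-hand side \<open>b\<close> of
  the definition is eliminated, so that each rule asks only that the product lie in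
  \<open>H\<close>.\<close>

lemma subloopD:
  assumes "subloop H G"
  shows "H \<subseteq> carrier G"
    and "\<lbrakk>a \<in> H; b \<in> H\<rbrakk> \<Longrightarrow> a \<otimes>\<^bsub>G\<^esub> b \<in> H"
    and "\<lbrakk>a \<in> H; x \<in> carrier G; a \<otimes>\<^bsub>G\<^esub> x \<in> H\<rbrakk> \<Longrightarrow> x \<in> H"
    and "\<lbrakk>a \<in> H; y \<in> carrier G; y \<otimes>\<^bsub>G\<^esub> a \<in> H\<rbrakk> \<Longrightarrow> y \<in> H"
  using assms unfolding subloop_def by blast+

lemma subloopI:
  assumes "H \<subseteq> carrier G" "c \<in> H"
    and "\<And>a b. \<lbrakk>a \<in> H; b \<in> H\<rbrakk> \<Longrightarrow> a \<otimes>\<^bsub>G\<^esub> b \<in> H"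
    and "\<And>a x. \<lbrakk>a \<in> H; x \<in> carrier G; a \<otimes>\<^bsub>G\<^esub> x \<in> H\<rbrakk> \<Longrightarrow> x \<in> H"
    and "\<And>a y. \<lbrakk>a \<in> H; y \<in> carrier G; y \<otimes>\<^bsub>G\<^esub> a \<in> H\<rbrakk> \<Longrightarrow> y \<in> H"
  shows "subloop H G"
  unfolding subloop_def
proof (intro conjI ballI impI)
  show "H \<noteq> {}" using assms(2) by blast
qed (metis assms)+

lemma normal_subloopD:
  assumes "normal_subloop K G"
  shows "subloop K G"
    and "a \<in> carrier G \<Longrightarrow> a <#\<^bsub>G\<^esub> K = K #>\<^bsub>G\<^esub> a"
    and "\<lbrakk>a \<in> carrier G; b \<in> carrier G\<rbrakk> \<Longrightarrow>
      (a \<otimes>\<^bsub>G\<^esub> b) <#\<^bsub>G\<^esub> K = a <#\<^bsub>G\<^esub> (b <#\<^bsub>G\<^esub> K)"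
    and "\<lbrakk>a \<in> carrier G; b \<in> carrier G\<rbrakk> \<Longrightarrow>
      (K #>\<^bsub>G\<^esub> a) #>\<^bsub>G\<^esub> b = K #>\<^bsub>G\<^esub> (a \<otimes>\<^bsub>G\<^esub> b)"
  using assms unfolding normal_subloop_def by blast+

section \<open>Cosets of a normal subloop as congruence classes\<close>

context loop
begin

lemma l_cancel: "\<lbrakk>a \<in> carrier G; x \<in> carrier G; y \<in> carrier G\<rbrakk> \<Longrightarrow> a \<otimes> x = a \<otimes> y \<longleftrightarrow> x = y"
  using right_solution[of a "a \<otimes> y"] m_closed by metis

lemma r_cancel: "\<lbrakk>a \<in> carrier G; x \<in> carrier G; y \<in> carrier G\<rbrakk> \<Longrightarrow> x \<otimes> a = y \<otimes> a \<longleftrightarrow> x = y"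
  using left_solution[of a "y \<otimes> a"] m_closed by metis

lemma right_solutionE:
  assumes "a \<in> carrier G" "b \<in> carrier G"
  obtains x where "x \<in> carrier G" "a \<otimes> x = b"
  using right_solution[OF assms] by blast

lemma left_solutionE:
  assumes "a \<in> carrier G" "b \<in> carrier G"
  obtains y where "y \<in> carrier G" "y \<otimes> a = b"
  using left_solution[OF assms] by blast

lemma one_mem_subloop:
  assumes "subloop H G"
  shows "\<one> \<in> H"
proof -
  obtain a where "a \<in> H" using assms unfolding subloop_def by blast
  \<comment> \<open>The identity solves \<open>a \<otimes> x = a\<close>, so closure under division
    puts it into \<open>H\<close>.\<close>
  then show ?thesis
    using subloopD[OF assms] r_one one_closed by (metis subset_iff)
qed

lemma subloop_carrier: "subloop (carrier G) G"
  unfolding subloop_def using one_closed m_closed by blast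

lemma l_coset_subset: "\<lbrakk>a \<in> carrier G; K \<subseteq> carrier G\<rbrakk> \<Longrightarrow> a <# K \<subseteq> carrier G"
  by (auto simp: mem_l_coset_iff subset_iff m_closed)

lemma r_coset_subset: "\<lbrakk>a \<in> carrier G; K \<subseteq> carrier G\<rbrakk> \<Longrightarrow> K #> a \<subseteq> carrier G"
  by (auto simp: mem_r_coset_iff subset_iff m_closed)

lemma l_coset_subloop:
  assumes "subloop K G" "k \<in> K"
  shows "k <# K = K"
proof
  show "k <# K \<subseteq> K" using subloopD(2)[OF assms(1)] assms(2) by (auto simp: mem_l_coset_iff)
  show "K \<subseteq> k <# K"
  proof
    fix b assume b: "b \<in> K"
    then obtain x where "x \<in> carrier G" "k \<otimes> x = b"
      using right_solutionE[of k b] subloopD(1)[OF assms(1)] assms(2) by blast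
    then show "b \<in> k <# K"
      using subloopD(3)[OF assms(1,2)] b by (auto simp: mem_l_coset_iff)
  qed
qed

lemma r_coset_subloop:
  assumes "subloop K G" "k \<in> K"
  shows "K #> k = K"
proof
  show "K #> k \<subseteq> K" using subloopD(2)[OF assms(1)] assms(2) by (auto simp: mem_r_coset_iff)
  show "K \<subseteq> K #> k"
  proof
    fix b assume b: "b \<in> K"
    then obtain y where "y \<in> carrier G" "y \<otimes> k = b"
      using left_solutionE[of k b] subloopD(1)[OF assms(1)] assms(2) by blast
    then show "b \<in> K #> k"
      using subloopD(4)[OF assms(1,2)] b by (auto simp: mem_r_coset_iff)
  qed
qed

lemma normal_subloop_carrier: "normal_subloop (carrier G) G"
  unfolding normal_subloop_def
  using subloop_carrier l_coset_subloop[OF subloop_carrier] r_coset_subloop[OF subloop_carrier]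
    m_closed by simp

lemma mem_l_coset_self:
  assumes "subloop K G" "a \<in> carrier G"
  shows "a \<in> a <# K"
  using one_mem_subloop[OF assms(1)] r_one[OF assms(2)] by (force simp: mem_l_coset_iff)

lemma one_l_coset:
  assumes "subloop K G"
  shows "\<one> <# K = K"
  using l_coset_subloop[OF assms one_mem_subloop[OF assms]] .

text \<open>If \<open>b = a \<otimes> k\<close>, normality gives (a k) K = a (k K) = a K. This
  replaces the associative argument that cosets partition the loop, and turns membership in a coset
  into an equality that can be rewritten with.\<close>

lemma normal_l_coset_eq_iff:
  assumes K: "normal_subloop K G" and ab: "a \<in> carrier G" "b \<in> carrier G"
  shows "b <# K = a <# K \<longleftrightarrow> b \<in> a <# K"
proof
  assume "b \<in> a <# K"
  then obtain k where k: "k \<in> K" "b = a \<otimes> k" by (auto simp: mem_l_coset_iff)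
  then show "b <# K = a <# K"
    using normal_subloopD(3)[OF K ab(1), of k] l_coset_subloop[OF normal_subloopD(1)[OF K] k(1)]
      subloopD(1)[OF normal_subloopD(1)[OF K]] by auto
next
  assume "b <# K = a <# K"
  then show "b \<in> a <# K" using mem_l_coset_self[OF normal_subloopD(1)[OF K] ab(2)] by simp
qed

text \<open>Since (a b) K = K (a b) = (K a) b = (a K) b, the factor \<open>b\<close> can be
  cancelled. Together with the left-hand version this says that congruence modulo \<open>K\<close>
  is compatible with products and can be cancelled on both sides.\<close>

lemma normal_mult_right_cong:
  assumes K: "normal_subloop K G" and "a \<in> carrier G" "b \<in> carrier G" "x \<in> carrier G"
  shows "x \<otimes> b \<in> (a \<otimes> b) <# K \<longleftrightarrow> x \<in> a <# K"
proof -
  have "(a \<otimes> b) <# K = (a <# K) #> b"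
    using normal_subloopD[OF K] assms m_closed by metis
  then show ?thesis
    using r_cancel[OF assms(3,4)] l_coset_subset[OF assms(2) subloopD(1)[OF normal_subloopD(1)[OF K]]]
    by (auto simp: mem_r_coset_iff)
qed

lemma normal_mult_left_cong:
  assumes K: "normal_subloop K G" and "a \<in> carrier G" "b \<in> carrier G" "x \<in> carrier G"
  shows "a \<otimes> x \<in> (a \<otimes> b) <# K \<longleftrightarrow> x \<in> b <# K"
proof -
  have "(a \<otimes> b) <# K = a <# (b <# K)"
    using normal_subloopD[OF K] assms by metis
  then show ?thesis
    using l_cancel[OF assms(2,4)] l_coset_subset[OF assms(3) subloopD(1)[OF normal_subloopD(1)[OF K]]]
    by (auto simp: mem_l_coset_iff[of _ _ a])
qed

text \<open>All computations are done modulo \<open>K\<close>: elements of the product set are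
  congruent to elements of \<open>M\<close>, and \<open>M\<close> is closed under the loop
  operations.\<close>

lemma subloop_set_mult:
  assumes M: "subloop M G" and K: "normal_subloop K G"
  shows "subloop (M <#> K) G"
proof -
  have MC: "M \<subseteq> carrier G" and KC: "K \<subseteq> carrier G"
    using subloopD(1) M normal_subloopD(1)[OF K] by auto
  have C: "M <#> K \<subseteq> carrier G"
    using MC l_coset_subset[OF _ KC] by (fastforce simp: mem_set_mult_iff)
  have eq: "b <# K = a <# K" if "b \<in> a <# K" "a \<in> M" for a b
    using normal_l_coset_eq_iff[OF K] that l_coset_subset[OF _ KC] MC by blast
  show ?thesis unfolding subloop_def
  proof (intro conjI ballI impI)
    show "M <#> K \<subseteq> carrier G" by (fact C)
    show "M <#> K \<noteq> {}"
      using one_mem_subloop M mem_l_coset_self[OF normal_subloopD(1)[OF K]] one_closed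
      by (metis mem_set_mult_iff empty_iff)
    fix u v assume uv: "u \<in> M <#> K" "v \<in> M <#> K"
    then obtain m n where mn: "m \<in> M" "u \<in> m <# K" "n \<in> M" "v \<in> n <# K"
      by (auto simp: mem_set_mult_iff)
    have c: "u \<in> carrier G" "v \<in> carrier G" "m \<in> carrier G" "n \<in> carrier G"
      using uv C mn MC by auto
    \<comment> \<open>Modulo \<open>K\<close>, the factor \<open>u\<close> may be traded for its
      representative \<open>m\<close>, here on the left and next on the right.\<close>
    have uw: "(u \<otimes> w) <# K = (m \<otimes> w) <# K" if "w \<in> carrier G" for w
      using normal_mult_right_cong[OF K c(3) that c(1)] normal_l_coset_eq_iff[OF K] mn(2) c that
        m_closed by metis
    have wu: "(w \<otimes> u) <# K = (w \<otimes> m) <# K" if "w \<in> carrier G" for w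
      using normal_mult_left_cong[OF K that c(3,1)] normal_l_coset_eq_iff[OF K] mn(2) c that
        m_closed by metis
    have "u \<otimes> v \<in> (u \<otimes> n) <# K"
      using normal_mult_left_cong[OF K c(1,4,2)] mn(4) by simp
    then show "u \<otimes> v \<in> M <#> K"
      using uw[OF c(4)] subloopD(2)[OF M mn(1,3)] by (auto simp: mem_set_mult_iff)
    {
      fix x assume x: "x \<in> carrier G" "u \<otimes> x = v"
      \<comment> \<open>The division is first carried out among the representatives, inside
        \<open>M\<close>. Then m x is congruent to u x = v, hence to n = m z, and cancelling
        \<open>m\<close> makes \<open>x\<close> congruent to \<open>z\<close>.\<close>
      obtain z where z: "z \<in> carrier G" "m \<otimes> z = n" using right_solutionE c by blast
      then have zM: "z \<in> M" using subloopD(3)[OF M mn(1)] mn(3) by blast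
      have "(m \<otimes> x) <# K = (m \<otimes> z) <# K" using uw[OF x(1)] x(2) z eq[OF mn(4,3)] by simp
      then have "m \<otimes> x \<in> (m \<otimes> z) <# K"
        using normal_l_coset_eq_iff[OF K] m_closed c x z by metis
      then show "x \<in> M <#> K"
        using normal_mult_left_cong[OF K c(3) z(1) x(1)] zM by (auto simp: mem_set_mult_iff)
    next
      fix y assume y: "y \<in> carrier G" "y \<otimes> u = v"
      obtain z where z: "z \<in> carrier G" "z \<otimes> m = n" using left_solutionE c by blast
      then have zM: "z \<in> M" using subloopD(4)[OF M mn(1)] mn(3) by blast
      have "(y \<otimes> m) <# K = (z \<otimes> m) <# K" using wu[OF y(1)] y(2) z eq[OF mn(4,3)] by simp
      then have "y \<otimes> m \<in> (z \<otimes> m) <# K"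
        using normal_l_coset_eq_iff[OF K] m_closed c y z by metis
      then show "y \<in> M <#> K"
        using normal_mult_right_cong[OF K z(1) c(3) y(1)] zM by (auto simp: mem_set_mult_iff)
    }
  qed
qed

section \<open>Intersections of subloops\<close>

lemma l_coset_INT:
  assumes "I \<noteq> {}" "a \<in> carrier G" "\<And>i. i \<in> I \<Longrightarrow> H i \<subseteq> carrier G"
  shows "a <# (\<Inter>i\<in>I. H i) = (\<Inter>i\<in>I. a <# H i)"
proof -
  \<comment> \<open>A coset is an image under a translation; translations are injective on the
    carrier, so they commute with nonempty intersections.\<close>
  have "a <# X = (\<otimes>) a ` X" for X by (auto simp: mem_l_coset_iff)
  moreover have "inj_on ((\<otimes>) a) (carrier G)" using l_cancel assms(2) by (auto intro: inj_onI)
  ultimately show ?thesis using image_INT[of "(\<otimes>) a" "carrier G" I H] assms by auto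
qed

lemma r_coset_INT:
  assumes "I \<noteq> {}" "a \<in> carrier G" "\<And>i. i \<in> I \<Longrightarrow> H i \<subseteq> carrier G"
  shows "(\<Inter>i\<in>I. H i) #> a = (\<Inter>i\<in>I. H i #> a)"
proof -
  have "X #> a = (\<lambda>x. x \<otimes> a) ` X" for X by (auto simp: mem_r_coset_iff)
  moreover have "inj_on (\<lambda>x. x \<otimes> a) (carrier G)" using r_cancel assms(2) by (auto intro: inj_onI)
  ultimately show ?thesis using image_INT[of "\<lambda>x. x \<otimes> a" "carrier G" I H] assms by auto
qed

lemma subloop_INT:
  assumes "I \<noteq> {}" and H: "\<And>i. i \<in> I \<Longrightarrow> subloop (H i) G"
  shows "subloop (\<Inter>i\<in>I. H i) G"
proof -
  show ?thesis
  proof (rule subloopI)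
    show "(\<Inter>i\<in>I. H i) \<subseteq> carrier G" using subloopD(1)[OF H] assms(1) by blast
    show "\<one> \<in> (\<Inter>i\<in>I. H i)" using one_mem_subloop H by blast
    show "a \<otimes> b \<in> (\<Inter>i\<in>I. H i)" if "a \<in> (\<Inter>i\<in>I. H i)" "b \<in> (\<Inter>i\<in>I. H i)" for a b
      using subloopD(2)[OF H] that by blast
    show "x \<in> (\<Inter>i\<in>I. H i)"
      if "a \<in> (\<Inter>i\<in>I. H i)" "x \<in> carrier G" "a \<otimes> x \<in> (\<Inter>i\<in>I. H i)" for a x
      using subloopD(3)[OF H] that by blast
    show "x \<in> (\<Inter>i\<in>I. H i)"
      if "a \<in> (\<Inter>i\<in>I. H i)" "x \<in> carrier G" "x \<otimes> a \<in> (\<Inter>i\<in>I. H i)" for a x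
      using subloopD(4)[OF H] that by blast
  qed
qed

text \<open>Each normality condition is an equation between cosets, so it passes to the intersection
  once translations have been moved inside it.\<close>

lemma normal_subloop_INT:
  assumes I: "I \<noteq> {}" and H: "\<And>i. i \<in> I \<Longrightarrow> normal_subloop (H i) G"
  shows "normal_subloop (\<Inter>i\<in>I. H i) G"
proof -
  have HC: "H i \<subseteq> carrier G" if "i \<in> I" for i
    using subloopD(1) normal_subloopD(1) H that by blast
  note l = l_coset_INT[OF I] and r = r_coset_INT[OF I]
  have "subloop (\<Inter>i\<in>I. H i) G" using subloop_INT[OF I] normal_subloopD(1)[OF H] by blast
  moreover have "a <# (\<Inter>i\<in>I. H i) = (\<Inter>i\<in>I. H i) #> a" if "a \<in> carrier G" for a
    using that by (simp add: l r HC normal_subloopD(2)[OF H])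
  moreover have "(a \<otimes> b) <# (\<Inter>i\<in>I. H i) = a <# (b <# (\<Inter>i\<in>I. H i))"
    if "a \<in> carrier G" "b \<in> carrier G" for a b
    using that by (simp add: l HC m_closed l_coset_subset normal_subloopD(3)[OF H])
  moreover have "((\<Inter>i\<in>I. H i) #> a) #> b = (\<Inter>i\<in>I. H i) #> (a \<otimes> b)"
    if "a \<in> carrier G" "b \<in> carrier G" for a b
    using that by (simp add: r HC m_closed r_coset_subset normal_subloopD(4)[OF H])
  ultimately show ?thesis unfolding normal_subloop_def by blast
qed

end

section \<open>Images and preimages under loop homomorphisms\<close>

lemma subloop_hom_image:
  assumes "loop G" "loop H" and h: "h \<in> hom G H" and I: "subloop I G"
  shows "subloop (h ` I) H"
proof -
  interpret G: loop G by fact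
  interpret H: loop H by fact
  have IC: "I \<subseteq> carrier G" using subloopD(1)[OF I] .
  have hc: "h x \<in> carrier H" if "x \<in> carrier G" for x using hom_in_carrier[OF h that] .
  have hm: "h (x \<otimes>\<^bsub>G\<^esub> y) = h x \<otimes>\<^bsub>H\<^esub> h y" if "x \<in> carrier G" "y \<in> carrier G" for x y
    using hom_mult[OF h that] .
  have sum: "h i \<otimes>\<^bsub>H\<^esub> h j \<in> h ` I" if "i \<in> I" "j \<in> I" for i j
    using hm subloopD(2)[OF I that] that IC by (metis imageI subsetD)
  have right: "x \<in> h ` I"
    if ij: "i \<in> I" "j \<in> I" and x: "x \<in> carrier H" "h i \<otimes>\<^bsub>H\<^esub> x = h j" for i j x
  proof -
    \<comment> \<open>The equation is solved in \<open>G\<close>, where the solution stays in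
      \<open>I\<close>; cancellation in \<open>H\<close> identifies \<open>x\<close> with the image
      of that solution.\<close>
    obtain z where z: "z \<in> carrier G" "i \<otimes>\<^bsub>G\<^esub> z = j"
      using G.right_solutionE[of i j] ij IC by blast
    then have "h i \<otimes>\<^bsub>H\<^esub> x = h i \<otimes>\<^bsub>H\<^esub> h z" using hm ij IC x by auto
    then have "x = h z" using H.l_cancel hc ij IC x z by blast
    then show ?thesis using subloopD(3)[OF I] ij z by blast
  qed
  have left: "y \<in> h ` I"
    if ij: "i \<in> I" "j \<in> I" and y: "y \<in> carrier H" "y \<otimes>\<^bsub>H\<^esub> h i = h j" for i j y
  proof -
    obtain z where z: "z \<in> carrier G" "z \<otimes>\<^bsub>G\<^esub> i = j"
      using G.left_solutionE[of i j] ij IC by blast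
    then have "y \<otimes>\<^bsub>H\<^esub> h i = h z \<otimes>\<^bsub>H\<^esub> h i" using hm ij IC y by auto
    then have "y = h z" using H.r_cancel hc ij IC y z by blast
    then show ?thesis using subloopD(4)[OF I] ij z by blast
  qed
  show ?thesis
  proof (rule subloopI)
    show "h ` I \<subseteq> carrier H" using IC hc by blast
    show "h \<one>\<^bsub>G\<^esub> \<in> h ` I" using G.one_mem_subloop[OF I] by blast
  qed (use sum right left in \<open>metis imageE\<close>)+
qed

lemma subloop_hom_vimage:
  assumes "loop G" "loop H" and h: "h \<in> hom G H" and K: "subloop K H"
  shows "subloop {x \<in> carrier G. h x \<in> K} G"
proof -
  interpret G: loop G by fact
  interpret H: loop H by fact
  have hc: "h x \<in> carrier H" if "x \<in> carrier G" for x using hom_in_carrier[OF h that] .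
  have hm: "h (x \<otimes>\<^bsub>G\<^esub> y) = h x \<otimes>\<^bsub>H\<^esub> h y" if "x \<in> carrier G" "y \<in> carrier G" for x y
    using hom_mult[OF h that] .
  \<comment> \<open>The image of the identity is idempotent, and by cancellation the identity is the
    only idempotent of a loop.\<close>
  have "h \<one>\<^bsub>G\<^esub> \<otimes>\<^bsub>H\<^esub> h \<one>\<^bsub>G\<^esub> = h \<one>\<^bsub>G\<^esub> \<otimes>\<^bsub>H\<^esub> \<one>\<^bsub>H\<^esub>"
    using hm[OF G.one_closed G.one_closed] G.r_one[OF G.one_closed]
      H.r_one[OF hc[OF G.one_closed]] by simp
  then have "h \<one>\<^bsub>G\<^esub> = \<one>\<^bsub>H\<^esub>"
    using H.l_cancel hc G.one_closed H.one_closed by blast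
  then have one: "\<one>\<^bsub>G\<^esub> \<in> {x \<in> carrier G. h x \<in> K}"
    using H.one_mem_subloop[OF K] G.one_closed by simp
  have sum: "a \<otimes>\<^bsub>G\<^esub> b \<in> {x \<in> carrier G. h x \<in> K}"
    if "a \<in> {x \<in> carrier G. h x \<in> K}" "b \<in> {x \<in> carrier G. h x \<in> K}" for a b
    using that hm subloopD(2)[OF K] G.m_closed by simp
  have right: "x \<in> {x \<in> carrier G. h x \<in> K}"
    if "a \<in> {x \<in> carrier G. h x \<in> K}" "x \<in> carrier G"
      "a \<otimes>\<^bsub>G\<^esub> x \<in> {x \<in> carrier G. h x \<in> K}" for a x
    using that hm subloopD(3)[OF K, of "h a" "h x"] hc by simp
  have left: "x \<in> {x \<in> carrier G. h x \<in> K}"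
    if "a \<in> {x \<in> carrier G. h x \<in> K}" "x \<in> carrier G"
      "x \<otimes>\<^bsub>G\<^esub> a \<in> {x \<in> carrier G. h x \<in> K}" for a x
    using that hm subloopD(4)[OF K, of "h a" "h x"] hc by simp
  show ?thesis
    by (rule subloopI[OF _ one sum right left]) auto
qed

lemma normal_subloop_hom_vimage:
  assumes "loop G" "loop H" and h: "h \<in> hom G H" and K: "normal_subloop K H"
  shows "normal_subloop {x \<in> carrier G. h x \<in> K} G" (is "normal_subloop ?P G")
proof -
  interpret G: loop G by fact
  interpret H: loop H by fact
  have hc: "h x \<in> carrier H" if "x \<in> carrier G" for x using hom_in_carrier[OF h that] .
  have hm: "h (x \<otimes>\<^bsub>G\<^esub> y) = h x \<otimes>\<^bsub>H\<^esub> h y" if "x \<in> carrier G" "y \<in> carrier G" for x y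
    using hom_mult[OF h that] .
  \<comment> \<open>Preimages commute with translations even when \<open>h\<close> is not
    surjective: if h y = h a k, then \<open>k\<close> is the image of the solution of a x = y.
    Allowing any \<open>X\<close> lets the formula be applied twice to nested cosets.\<close>
  have l: "a <#\<^bsub>G\<^esub> {x \<in> carrier G. h x \<in> X} = {x \<in> carrier G. h x \<in> h a <#\<^bsub>H\<^esub> X}"
    if a: "a \<in> carrier G" and X: "X \<subseteq> carrier H" for a X
  proof (intro equalityI subsetI)
    fix y assume "y \<in> a <#\<^bsub>G\<^esub> {x \<in> carrier G. h x \<in> X}"
    then show "y \<in> {x \<in> carrier G. h x \<in> h a <#\<^bsub>H\<^esub> X}"
      using hm a G.m_closed by (auto simp: mem_l_coset_iff)
  next
    fix y assume "y \<in> {x \<in> carrier G. h x \<in> h a <#\<^bsub>H\<^esub> X}"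
    then obtain k where y: "y \<in> carrier G" "k \<in> X" "h y = h a \<otimes>\<^bsub>H\<^esub> k"
      by (auto simp: mem_l_coset_iff)
    obtain x where x: "x \<in> carrier G" "a \<otimes>\<^bsub>G\<^esub> x = y" using G.right_solutionE a y by blast
    then have "h a \<otimes>\<^bsub>H\<^esub> h x = h a \<otimes>\<^bsub>H\<^esub> k" using hm a y by auto
    then have "h x = k" using H.l_cancel hc a x y X by blast
    then show "y \<in> a <#\<^bsub>G\<^esub> {x \<in> carrier G. h x \<in> X}" using x y by (auto simp: mem_l_coset_iff)
  qed
  have r: "{x \<in> carrier G. h x \<in> X} #>\<^bsub>G\<^esub> a = {x \<in> carrier G. h x \<in> X #>\<^bsub>H\<^esub> h a}"
    if a: "a \<in> carrier G" and X: "X \<subseteq> carrier H" for a X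
  proof (intro equalityI subsetI)
    fix y assume "y \<in> {x \<in> carrier G. h x \<in> X} #>\<^bsub>G\<^esub> a"
    then show "y \<in> {x \<in> carrier G. h x \<in> X #>\<^bsub>H\<^esub> h a}"
      using hm a G.m_closed by (auto simp: mem_r_coset_iff)
  next
    fix y assume "y \<in> {x \<in> carrier G. h x \<in> X #>\<^bsub>H\<^esub> h a}"
    then obtain k where y: "y \<in> carrier G" "k \<in> X" "h y = k \<otimes>\<^bsub>H\<^esub> h a"
      by (auto simp: mem_r_coset_iff)
    obtain x where x: "x \<in> carrier G" "x \<otimes>\<^bsub>G\<^esub> a = y" using G.left_solutionE a y by blast
    then have "h x \<otimes>\<^bsub>H\<^esub> h a = k \<otimes>\<^bsub>H\<^esub> h a" using hm a y by auto
    then have "h x = k" using H.r_cancel hc a x y X by blast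
    then show "y \<in> {x \<in> carrier G. h x \<in> X} #>\<^bsub>G\<^esub> a" using x y by (auto simp: mem_r_coset_iff)
  qed
  have KC: "K \<subseteq> carrier H" using subloopD(1)[OF normal_subloopD(1)[OF K]] .
  have "a <#\<^bsub>G\<^esub> ?P = ?P #>\<^bsub>G\<^esub> a" if "a \<in> carrier G" for a
    using that by (simp add: l r hc KC normal_subloopD(2)[OF K])
  moreover have "(a \<otimes>\<^bsub>G\<^esub> b) <#\<^bsub>G\<^esub> ?P = a <#\<^bsub>G\<^esub> (b <#\<^bsub>G\<^esub> ?P)"
    if "a \<in> carrier G" "b \<in> carrier G" for a b
    using that
    by (simp add: l hc hm KC G.m_closed H.l_coset_subset normal_subloopD(3)[OF K])
  moreover have "(?P #>\<^bsub>G\<^esub> a) #>\<^bsub>G\<^esub> b = ?P #>\<^bsub>G\<^esub> (a \<otimes>\<^bsub>G\<^esub> b)"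
    if "a \<in> carrier G" "b \<in> carrier G" for a b
    using that
    by (simp add: r hc hm KC G.m_closed H.r_coset_subset normal_subloopD(4)[OF K])
  ultimately show ?thesis
    unfolding normal_subloop_def
    using subloop_hom_vimage[OF assms(1-3) normal_subloopD(1)[OF K]] by blast
qed

section \<open>Left ideals and maximal left subloops\<close>

lemma left_N_subloopD:
  assumes "left_N_subloop N I"
  shows "subloop I (add_monoid N)" "I \<subseteq> carrier N"
    and "\<lbrakk>n \<in> carrier N; i \<in> I\<rbrakk> \<Longrightarrow> n \<otimes>\<^bsub>N\<^esub> i \<in> I"
    and "\<lbrakk>a \<in> I; b \<in> I\<rbrakk> \<Longrightarrow> a \<oplus>\<^bsub>N\<^esub> b \<in> I"
  using assms subloopD(1,2)[of I "add_monoid N"] unfolding left_N_subloop_def by auto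

lemma maximal_left_N_subloopD:
  assumes "maximal_left_N_subloop N M"
  shows "left_N_subloop N M" "M \<noteq> carrier N"
    and "\<lbrakk>left_N_subloop N I; M \<subseteq> I\<rbrakk> \<Longrightarrow> I = M \<or> I = carrier N"
  using assms unfolding maximal_left_N_subloop_def by blast+

context loop_near_ring
begin

sublocale add: loop "add_monoid N"
  rewrites "carrier (add_monoid N) = carrier N"
    and "mult (add_monoid N) = add N"
    and "one (add_monoid N) = zero N"
    and "l_coset (add_monoid N) = a_l_coset N"
  by (simp_all add: add_loop a_l_coset_def)

lemma mem_a_l_coset_iff: "y \<in> a <+ K \<longleftrightarrow> (\<exists>k\<in>K. y = a \<oplus> k)"
  by (simp add: a_l_coset_def mem_l_coset_iff)

lemma mem_set_add_iff: "x \<in> M <+>\<^bsub>N\<^esub> K \<longleftrightarrow> (\<exists>m\<in>M. x \<in> m <+ K)"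
  by (simp add: set_add_def a_l_coset_def mem_set_mult_iff)

text \<open>Membership in a coset is easier to establish than equality of cosets, and for a normal
  subloop the two agree.\<close>

lemma left_ideal_iff:
  "left_ideal N K \<longleftrightarrow> normal_subloop K (add_monoid N) \<and>
    (\<forall>n\<in>carrier N. \<forall>a\<in>carrier N. \<forall>k\<in>K. n \<otimes> (a \<oplus> k) \<in> (n \<otimes> a) <+ K)"
proof (cases "normal_subloop K (add_monoid N)")
  case True
  have "K \<subseteq> carrier N" using subloopD(1)[OF normal_subloopD(1)[OF True]] by simp
  then have "(n \<otimes> (a \<oplus> k)) <+ K = (n \<otimes> a) <+ K \<longleftrightarrow> n \<otimes> (a \<oplus> k) \<in> (n \<otimes> a) <+ K"
    if "n \<in> carrier N" "a \<in> carrier N" "k \<in> K" for n a k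
    using add.normal_l_coset_eq_iff[OF True] mult_closed add.m_closed that
    by (simp add: subset_iff)
  then show ?thesis unfolding left_ideal_def by simp
qed (simp add: left_ideal_def)

lemma left_idealD:
  assumes "left_ideal N K"
  shows "normal_subloop K (add_monoid N)" "subloop K (add_monoid N)" "K \<subseteq> carrier N"
    and "\<lbrakk>n \<in> carrier N; a \<in> carrier N; k \<in> K\<rbrakk> \<Longrightarrow> n \<otimes> (a \<oplus> k) \<in> (n \<otimes> a) <+ K"
  using assms normal_subloopD(1)[of K "add_monoid N"] subloopD(1)[of K "add_monoid N"]
  unfolding left_ideal_iff by auto

lemma left_ideal_carrier: "left_ideal N (carrier N)"
proof -
  have "n \<otimes> (a \<oplus> k) \<in> (n \<otimes> a) <+ carrier N"
    if "n \<in> carrier N" "a \<in> carrier N" "k \<in> carrier N" for n a k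
    using add.l_coset_subloop[OF add.subloop_carrier] that mult_closed add.m_closed by simp
  then show ?thesis unfolding left_ideal_iff using add.normal_subloop_carrier by blast
qed

lemma left_ideal_Inter:
  assumes F: "F \<noteq> {}" and id: "\<And>K. K \<in> F \<Longrightarrow> left_ideal N K"
  shows "left_ideal N (\<Inter>F)"
proof -
  have "n \<otimes> (a \<oplus> k) \<in> (n \<otimes> a) <+ \<Inter>F"
    if "n \<in> carrier N" "a \<in> carrier N" "k \<in> \<Inter>F" for n a k
  proof -
    have "(n \<otimes> a) <+ \<Inter>F = (\<Inter>K\<in>F. (n \<otimes> a) <+ K)"
      using add.l_coset_INT[OF F, of "n \<otimes> a" "\<lambda>K. K"] mult_closed left_idealD(3)[OF id] that
      by simp
    then show ?thesis using left_idealD(4)[OF id] that by auto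
  qed
  moreover have "normal_subloop (\<Inter>F) (add_monoid N)"
    using add.normal_subloop_INT[OF F, of "\<lambda>K. K"] left_idealD(1)[OF id] by simp
  ultimately show ?thesis unfolding left_ideal_iff by blast
qed

lemma left_ideal_J\<^sub>2: "left_ideal N (J\<^sub>2 N)"
proof -
  \<comment> \<open>Adding the carrier keeps the family nonempty even if no \<open>N\<close>-maximal
    left ideal exists, and matches the convention in \<open>J\<^sub>2_def\<close>.\<close>
  have "left_ideal N (\<Inter>(insert (carrier N) {K. N_maximal_left_ideal N K}))"
    by (rule left_ideal_Inter) (use left_ideal_carrier in \<open>auto simp: N_maximal_left_ideal_def\<close>)
  then show ?thesis by (simp add: J\<^sub>2_def)
qed

lemma R_radical_subset_J\<^sub>2: "R_radical N \<subseteq> J\<^sub>2 N"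
  by (auto simp: R_radical_def J\<^sub>2_def N_maximal_left_ideal_def)

section \<open>Sums and right multiplication\<close>

lemma left_N_subloop_add:
  assumes M: "left_N_subloop N M" and L: "left_ideal N L"
  shows "left_N_subloop N (M <+>\<^bsub>N\<^esub> L)"
  unfolding left_N_subloop_def
proof (intro conjI ballI)
  show "subloop (M <+>\<^bsub>N\<^esub> L) (add_monoid N)"
    using add.subloop_set_mult[OF left_N_subloopD(1)[OF M] left_idealD(1)[OF L]]
    by (simp add: set_add_def)
  fix n x assume n: "n \<in> carrier N" and "x \<in> M <+>\<^bsub>N\<^esub> L"
  then obtain m l where m: "m \<in> M" "l \<in> L" "x = m \<oplus> l"
    by (auto simp: mem_set_add_iff mem_a_l_coset_iff)
  \<comment> \<open>Left multiplication need not distribute over \<open>m \<oplus> l\<close>, but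
    the left ideal condition places n (m + l) in the coset n m + L, and n m lies in
    \<open>M\<close>.\<close>
  then show "n \<otimes> x \<in> M <+>\<^bsub>N\<^esub> L"
    using left_idealD(4)[OF L n, of m l] left_N_subloopD(2,3)[OF M] n
    by (auto simp: mem_set_add_iff)
qed

lemma subset_set_add_left:
  assumes "M \<subseteq> carrier N" "subloop L (add_monoid N)"
  shows "M \<subseteq> M <+>\<^bsub>N\<^esub> L"
  using add.mem_l_coset_self[OF assms(2)] assms(1)
  unfolding subset_iff mem_set_add_iff by blast

lemma subset_set_add_right:
  assumes "subloop M (add_monoid N)" "subloop L (add_monoid N)"
  shows "L \<subseteq> M <+>\<^bsub>N\<^esub> L"
  using add.one_mem_subloop[OF assms(1)] add.one_l_coset[OF assms(2)]
  unfolding subset_iff mem_set_add_iff by blast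

lemma right_mult_hom:
  "n \<in> carrier N \<Longrightarrow> (\<lambda>x. x \<otimes> n) \<in> hom (add_monoid N) (add_monoid N)"
  using mult_closed right_distrib by (auto simp: hom_def)

lemma left_N_subloop_image_right_mult:
  assumes I: "left_N_subloop N I" and n: "n \<in> carrier N"
  shows "left_N_subloop N ((\<lambda>x. x \<otimes> n) ` I)"
proof -
  have "m \<otimes> (i \<otimes> n) \<in> (\<lambda>x. x \<otimes> n) ` I" if "m \<in> carrier N" "i \<in> I" for m i
    using mult_assoc[OF that(1) _ n, of i] left_N_subloopD(2,3)[OF I] that
    by (metis imageI subsetD)
  then show ?thesis
    unfolding left_N_subloop_def
    using subloop_hom_image[OF add_loop add_loop right_mult_hom[OF n] left_N_subloopD(1)[OF I]]
    by blast
qed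

lemma left_ideal_vimage_right_mult:
  assumes K: "left_ideal N K" and n: "n \<in> carrier N"
  shows "left_ideal N {x \<in> carrier N. x \<otimes> n \<in> K}" (is "left_ideal N ?P")
  unfolding left_ideal_iff
proof (intro conjI ballI)
  show "normal_subloop ?P (add_monoid N)"
    using normal_subloop_hom_vimage[OF add_loop add_loop right_mult_hom[OF n] left_idealD(1)[OF K]]
    by simp
  fix m a p assume m: "m \<in> carrier N" and a: "a \<in> carrier N" and p: "p \<in> ?P"
  have c: "m \<otimes> (a \<oplus> p) \<in> carrier N" "m \<otimes> a \<in> carrier N"
    using m a p mult_closed add.m_closed by auto
  \<comment> \<open>This \<open>x\<close> is the right difference of m (a + p) and m a. Multiplying
    by \<open>n\<close> and using the left ideal condition for \<open>K\<close> at a n and p n will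
    show that x n lies in \<open>K\<close>.\<close>
  obtain x where x: "x \<in> carrier N" "(m \<otimes> a) \<oplus> x = m \<otimes> (a \<oplus> p)"
    using add.right_solutionE c by blast
  have "(m \<otimes> (a \<oplus> p)) \<otimes> n = m \<otimes> (a \<otimes> n \<oplus> p \<otimes> n)"
    using mult_assoc right_distrib add.m_closed m a p n by simp
  also have "\<dots> \<in> (m \<otimes> (a \<otimes> n)) <+ K"
    using left_idealD(4)[OF K m] mult_closed a n p by blast
  finally have "(m \<otimes> a) \<otimes> n \<oplus> x \<otimes> n \<in> (m \<otimes> a \<otimes> n) <+ K"
    using right_distrib[OF c(2) x(1) n] x(2) mult_assoc[OF m a n] by simp
  then have "x \<otimes> n \<in> K"
    using add.l_cancel mult_closed[OF c(2) n] mult_closed[OF x(1) n] left_idealD(3)[OF K]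
    by (auto simp: mem_a_l_coset_iff)
  then show "m \<otimes> (a \<oplus> p) \<in> (m \<otimes> a) <+ ?P" using x by (auto simp: mem_a_l_coset_iff)
qed

text \<open>The left ideal condition at a = 0 gives that n k lies in n 0 + K, which is
  \<open>K\<close> by zero-symmetry.\<close>

lemma left_ideal_imp_left_N_subloop:
  assumes "zero_symmetric N" and K: "left_ideal N K"
  shows "left_N_subloop N K"
proof -
  have "n \<otimes> k \<in> K" if "n \<in> carrier N" "k \<in> K" for n k
    using left_idealD(4)[OF K that(1) add.one_closed that(2)] that assms(1)
      add.one_l_coset[OF left_idealD(2)[OF K]] add.l_one[of k] left_idealD(3)[OF K]
    by (auto simp: zero_symmetric_def)
  then show ?thesis unfolding left_N_subloop_def using left_idealD(2)[OF K] by blast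
qed

lemma left_N_subloop_carrier: "left_N_subloop N (carrier N)"
  unfolding left_N_subloop_def using add.subloop_carrier mult_closed by blast

end

section \<open>Existence of maximal left subloops\<close>

context unital_loop_near_ring
begin

lemma left_N_subloop_eq_carrier_iff:
  assumes "left_N_subloop N I"
  shows "I = carrier N \<longleftrightarrow> \<one> \<in> I"
  using left_N_subloopD(2,3)[OF assms] mult_one_right one_in_carrier
  by (metis subsetI subset_antisym)

lemma left_N_subloop_Union_chain:
  assumes "C \<noteq> {}" and chain: "\<And>X Y. \<lbrakk>X \<in> C; Y \<in> C\<rbrakk> \<Longrightarrow> X \<subseteq> Y \<or> Y \<subseteq> X"
    and C: "\<And>X. X \<in> C \<Longrightarrow> left_N_subloop N X"
  shows "left_N_subloop N (\<Union>C)"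
proof -
  \<comment> \<open>In a chain, two elements always lie in a common member, where the closure rules
    apply.\<close>
  have common: "\<exists>X\<in>C. a \<in> X \<and> b \<in> X" if "a \<in> \<Union>C" "b \<in> \<Union>C" for a b
    using chain that by blast
  have sub: "subloop X (add_monoid N)" if "X \<in> C" for X
    using left_N_subloopD(1)[OF C[OF that]] .
  have "subloop (\<Union>C) (add_monoid N)"
  proof (rule subloopI, simp_all only: monoid.simps partial_object.simps)
    show "\<Union>C \<subseteq> carrier N" using left_N_subloopD(2)[OF C] by blast
    show "\<zero> \<in> \<Union>C" using assms(1) add.one_mem_subloop[OF sub] by blast
    show "a \<oplus> b \<in> \<Union>C" if "a \<in> \<Union>C" "b \<in> \<Union>C" for a b
      using common[OF that] left_N_subloopD(4)[OF C] by blast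
    show "x \<in> \<Union>C" if "a \<in> \<Union>C" "x \<in> carrier N" "a \<oplus> x \<in> \<Union>C" for a x
      using common[OF that(1,3)] subloopD(3)[OF sub, of _ a x] that(2) by auto
    show "x \<in> \<Union>C" if "a \<in> \<Union>C" "x \<in> carrier N" "x \<oplus> a \<in> \<Union>C" for a x
      using common[OF that(1,3)] subloopD(4)[OF sub, of _ a x] that(2) by auto
  qed
  then show ?thesis
    unfolding left_N_subloop_def using left_N_subloopD(3)[OF C] by blast
qed

lemma maximal_left_N_subloop_exists:
  assumes I: "left_N_subloop N I" "I \<noteq> carrier N"
  obtains M where "maximal_left_N_subloop N M" "I \<subseteq> M"
proof -
  let ?A = "{J. left_N_subloop N J \<and> J \<noteq> carrier N \<and> I \<subseteq> J}"
  have "\<exists>M\<in>?A. \<forall>X\<in>?A. M \<subseteq> X \<longrightarrow> X = M"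
  proof (rule subset_Zorn_nonempty)
    show "?A \<noteq> {}" using I by blast
    fix C assume "C \<noteq> {}" and C: "subset.chain ?A C"
    then have CA: "left_N_subloop N X" "X \<noteq> carrier N" "I \<subseteq> X" if "X \<in> C" for X
      using that by (auto simp: subset_chain_def)
    have U: "left_N_subloop N (\<Union>C)"
      using left_N_subloop_Union_chain[OF \<open>C \<noteq> {}\<close> _ CA(1)] C by (auto simp: subset_chain_def)
    \<comment> \<open>Properness survives unions of chains because it amounts to omitting the single
      element \<open>\<one>\<close>.\<close>
    moreover have "\<one> \<notin> \<Union>C" using CA(2) left_N_subloop_eq_carrier_iff[OF CA(1)] by blast
    moreover have "I \<subseteq> \<Union>C" using CA(3) \<open>C \<noteq> {}\<close> by blast
    ultimately show "\<Union>C \<in> ?A" using left_N_subloop_eq_carrier_iff[OF U] by blast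
  qed
  then obtain M where "M \<in> ?A" and max: "\<forall>X\<in>?A. M \<subseteq> X \<longrightarrow> X = M" by (rule bexE)
  then have M: "left_N_subloop N M" "M \<noteq> carrier N" "I \<subseteq> M" by auto
  have "X = M" if "left_N_subloop N X" "X \<noteq> carrier N" "M \<subseteq> X" for X
    using max that subset_trans[OF M(3) that(3)] by simp
  then have "maximal_left_N_subloop N M"
    unfolding maximal_left_N_subloop_def using M(1,2) by simp
  then show thesis using M(3) by (rule that)
qed

section \<open>Quasiregularity and \<open>R_radical\<close>\<close>

lemma quasiregular_elemI:
  assumes "q \<in> carrier N"
    and "\<And>y. \<lbrakk>y \<in> carrier N; y \<oplus> q = \<one>\<rbrakk> \<Longrightarrow> \<exists>z\<in>carrier N. z \<otimes> y = \<one>"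
  shows "quasiregular_elem N q"
  using assms theI'[OF add.left_solution[OF assms(1) one_in_carrier]]
  unfolding quasiregular_elem_def by blast

text \<open>Uniqueness of left solutions lets any \<open>y\<close> with
  \<open>y \<oplus> q = \<one>\<close> stand in for the definite description in
  \<open>quasiregular_elem\<close>.\<close>

lemma quasiregular_elemD:
  assumes "quasiregular_elem N q" "y \<in> carrier N" "y \<oplus> q = \<one>"
  shows "\<exists>z\<in>carrier N. z \<otimes> y = \<one>"
proof -
  have "q \<in> carrier N" using assms(1) unfolding quasiregular_elem_def by blast
  then have "(THE y. y \<in> carrier N \<and> y \<oplus> q = \<one>) = y"
    using the1_equality[OF add.left_solution[OF _ one_in_carrier]] assms(2,3) by blast
  then show ?thesis using assms(1) unfolding quasiregular_elem_def by auto
qed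

text \<open>The bound by \<open>R_radical N\<close> is sharper than the bound by
  \<open>J\<^sub>2 N\<close>; applied to \<open>J\<^sub>2 N\<close> itself, it forces the two
  radicals to coincide when \<open>J\<^sub>2 N\<close> is quasiregular.\<close>

lemma quasiregular_left_ideal_subset_R_radical:
  assumes L: "left_ideal N L" "quasiregular N L"
  shows "L \<subseteq> R_radical N"
proof -
  have "L \<subseteq> M" if max: "maximal_left_N_subloop N M" for M
  proof (rule ccontr)
    assume "\<not> L \<subseteq> M"
    note M = maximal_left_N_subloopD[OF max]
    have sub: "M \<subseteq> M <+>\<^bsub>N\<^esub> L" "L \<subseteq> M <+>\<^bsub>N\<^esub> L"
      using subset_set_add_left subset_set_add_right left_N_subloopD(1,2)[OF M(1)]
        left_idealD(2)[OF L(1)] by blast+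
    then have "M <+>\<^bsub>N\<^esub> L = carrier N"
      using M(3)[OF left_N_subloop_add[OF M(1) L(1)]] \<open>\<not> L \<subseteq> M\<close> by blast
    then obtain y q where yq: "y \<in> M" "q \<in> L" "y \<oplus> q = \<one>"
      using one_in_carrier mem_set_add_iff[of \<one> M L] mem_a_l_coset_iff[of \<one>] by metis
    then obtain z where "z \<in> carrier N" "z \<otimes> y = \<one>"
      using quasiregular_elemD[of q y] L(2) left_N_subloopD(2)[OF M(1)]
      unfolding quasiregular_def by blast
    then have "\<one> \<in> M" using left_N_subloopD(3)[OF M(1)] yq(1) by metis
    then show False using left_N_subloop_eq_carrier_iff M(1,2) by blast
  qed
  then show ?thesis using left_idealD(3)[OF L(1)] unfolding R_radical_def by blast
qed

lemma quasiregular_R_radical: "quasiregular N (R_radical N)"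
  unfolding quasiregular_def
proof
  fix q assume q: "q \<in> R_radical N"
  show "quasiregular_elem N q"
  proof (rule quasiregular_elemI)
    show "q \<in> carrier N" using q unfolding R_radical_def by blast
    fix y assume y: "y \<in> carrier N" "y \<oplus> q = \<one>"
    let ?Ny = "(\<lambda>x. x \<otimes> y) ` carrier N"
    have Ny: "left_N_subloop N ?Ny"
      using left_N_subloop_image_right_mult[OF left_N_subloop_carrier y(1)] .
    show "\<exists>z\<in>carrier N. z \<otimes> y = \<one>"
    proof (rule ccontr)
      assume "\<not> ?thesis"
      \<comment> \<open>A left inverse of \<open>y\<close> exists exactly when \<open>\<one>\<close>
        lies in \<open>?Ny\<close>.\<close>
      then have "?Ny \<noteq> carrier N" using one_in_carrier by force
      then obtain M where M: "maximal_left_N_subloop N M" "?Ny \<subseteq> M"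
        using maximal_left_N_subloop_exists[OF Ny] by blast
      have "y \<in> M" using M(2) mult_one_left[OF y(1)] one_in_carrier by (metis imageI subsetD)
      moreover have "q \<in> M" using q M(1) unfolding R_radical_def by blast
      ultimately have "\<one> \<in> M"
        using left_N_subloopD(4)[OF maximal_left_N_subloopD(1)[OF M(1)]] y(2) by metis
      then show False
        using left_N_subloop_eq_carrier_iff maximal_left_N_subloopD(1,2)[OF M(1)] by blast
    qed
  qed
qed

section \<open>Right multiplication and \<open>J\<^sub>2 N\<close>\<close>

lemma N_maximal_left_ideal_vimage_right_mult:
  assumes zs: "zero_symmetric N" and K: "N_maximal_left_ideal N K"
    and n: "n \<in> carrier N" "n \<notin> K"
  shows "N_maximal_left_ideal N {x \<in> carrier N. x \<otimes> n \<in> K}" (is "N_maximal_left_ideal N ?P")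
proof -
  have Kid: "left_ideal N K" and Kmax: "maximal_left_N_subloop N K"
    using K unfolding N_maximal_left_ideal_def by auto
  have P: "left_ideal N ?P" using left_ideal_vimage_right_mult[OF Kid n(1)] .
  have "\<one> \<notin> ?P" using n mult_one_left by simp
  then have proper: "?P \<noteq> carrier N" using one_in_carrier by blast
  \<comment> \<open>If \<open>I\<close> were strictly larger than \<open>?P\<close>, then I n would
    not lie in \<open>K\<close>, so maximality of \<open>K\<close> would give I n + K = N. Expanding
    \<open>n\<close> in this sum will produce \<open>\<one>\<close> in \<open>I\<close>.\<close>
  have "I = ?P" if I: "left_N_subloop N I" "I \<noteq> carrier N" "?P \<subseteq> I" for I
  proof (rule ccontr)
    assume "I \<noteq> ?P"
    then obtain i where i: "i \<in> I" "i \<otimes> n \<notin> K" using I left_N_subloopD(2)[OF I(1)] by blast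
    let ?In = "(\<lambda>x. x \<otimes> n) ` I"
    have In: "left_N_subloop N ?In" using left_N_subloop_image_right_mult[OF I(1) n(1)] .
    have "?In \<subseteq> ?In <+>\<^bsub>N\<^esub> K" "K \<subseteq> ?In <+>\<^bsub>N\<^esub> K"
      using subset_set_add_left subset_set_add_right left_N_subloopD(1,2)[OF In]
        left_idealD(2)[OF Kid] by blast+
    then have "?In <+>\<^bsub>N\<^esub> K = carrier N"
      using maximal_left_N_subloopD(3)[OF Kmax left_N_subloop_add[OF In Kid]] i by blast
    then have "n \<in> ?In <+>\<^bsub>N\<^esub> K" using n(1) by blast
    then obtain j k where j: "j \<in> I" "k \<in> K" "n = j \<otimes> n \<oplus> k"
      by (auto simp: mem_set_add_iff mem_a_l_coset_iff)
    then have jc: "j \<in> carrier N" and kc: "k \<in> carrier N"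
      using left_N_subloopD(2)[OF I(1)] left_idealD(3)[OF Kid] by auto
    \<comment> \<open>Writing 1 = j + x and multiplying by \<open>n\<close> gives j n + x n = n = j
      n + k. Hence x n = k lies in \<open>K\<close>, so \<open>x\<close> lies in \<open>?P\<close>
      and thus in \<open>I\<close>, as does \<open>j\<close>.\<close>
    obtain x where x: "x \<in> carrier N" "j \<oplus> x = \<one>"
      using add.right_solutionE jc one_in_carrier by blast
    then have "j \<otimes> n \<oplus> x \<otimes> n = j \<otimes> n \<oplus> k"
      using right_distrib[OF jc x(1) n(1)] mult_one_left[OF n(1)] j(3) by simp
    then have "x \<otimes> n = k" using add.l_cancel mult_closed jc n(1) x(1) kc by blast
    then have "x \<in> I" using x(1) j(2) I(3) by blast
    then have "\<one> \<in> I" using left_N_subloopD(4)[OF I(1) j(1)] x(2) by metis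
    then show False using left_N_subloop_eq_carrier_iff I by blast
  qed
  then show ?thesis
    unfolding N_maximal_left_ideal_def maximal_left_N_subloop_def
    using P left_ideal_imp_left_N_subloop[OF zs P] proper by blast
qed

lemma two_sided_ideal_J\<^sub>2:
  assumes zs: "zero_symmetric N"
  shows "two_sided_ideal N (J\<^sub>2 N)"
proof -
  have "k \<otimes> n \<in> J\<^sub>2 N" if k: "k \<in> J\<^sub>2 N" and n: "n \<in> carrier N" for k n
  proof -
    have kc: "k \<in> carrier N" using k unfolding J\<^sub>2_def by blast
    have "k \<otimes> n \<in> K" if K: "N_maximal_left_ideal N K" for K
    \<comment> \<open>For \<open>n\<close> in \<open>K\<close>, closure under left multiplication
      suffices. Otherwise the set of all \<open>x\<close> with x n in \<open>K\<close> is one of the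
      ideals intersected in \<open>J\<^sub>2 N\<close>, so it contains \<open>k\<close>.\<close>
    proof (cases "n \<in> K")
      case True
      have "left_N_subloop N K"
        using K maximal_left_N_subloopD(1) unfolding N_maximal_left_ideal_def by blast
      then show ?thesis using kc True by (rule left_N_subloopD(3))
    next
      case False
      then show ?thesis
        using N_maximal_left_ideal_vimage_right_mult[OF zs K n] k by (auto simp: J\<^sub>2_def)
    qed
    then show ?thesis using mult_closed[OF kc n] by (simp add: J\<^sub>2_def)
  qed
  then show ?thesis unfolding two_sided_ideal_def using left_ideal_J\<^sub>2 by blast
qed

end

theorem corollary2p5:
  fixes N :: "('a, 'b) ring_scheme"
  assumes "unital_loop_near_ring N"
    and "zero_symmetric N"
  shows "(\<forall>L. left_ideal N L \<and> quasiregular N L \<longrightarrow> L \<subseteq> J\<^sub>2 N) \<and>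
    (quasiregular N (J\<^sub>2 N) \<longleftrightarrow> J\<^sub>2 N = R_radical N) \<and>
    (J\<^sub>2 N = R_radical N \<longrightarrow>
      two_sided_ideal N (J\<^sub>2 N) \<and> quasiregular N (J\<^sub>2 N) \<and>
      (\<forall>K. two_sided_ideal N K \<and> quasiregular N K \<longrightarrow> K \<subseteq> J\<^sub>2 N))"
proof -
  interpret unital_loop_near_ring N by fact
  have L: "L \<subseteq> J\<^sub>2 N" if "left_ideal N L" "quasiregular N L" for L
    using quasiregular_left_ideal_subset_R_radical[OF that] R_radical_subset_J\<^sub>2 by blast
  \<comment> \<open>Forward, the left ideal \<open>J\<^sub>2 N\<close> falls inside
    \<open>R_radical N\<close>, which it always contains; backward, \<open>R_radical N\<close> is
    always quasiregular.\<close>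
  have "quasiregular N (J\<^sub>2 N) \<longleftrightarrow> J\<^sub>2 N = R_radical N"
    using quasiregular_left_ideal_subset_R_radical[OF left_ideal_J\<^sub>2] R_radical_subset_J\<^sub>2
      quasiregular_R_radical by auto
  then show ?thesis
    using L two_sided_ideal_J\<^sub>2[OF assms(2)] unfolding two_sided_ideal_def by blast
qed

end
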